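(* Let $X \in \{0,1\}^{N,M}$ be an $N \times M$ matrix with entries in $\{0,1\}$. Then $\mathrm{rk}_{\mathbb{Z}_2}(X) \le \mathrm{rk}_{\mathbb{R}}(X)$.
   Context: $\mathrm{rk}_{\mathbb{R}}(X) = \min\{R : X = WH,\ W \in \mathbb{R}^{N,R},\ H \in \mathbb{R}^{R,M}\}$ is the usual real rank of $X$. $\mathrm{rk}_{\mathbb{Z}_2}(X) = \min\{R : X = W \otimes H,\ W \in \mathbb{Z}_2^{N,R},\ H \in \mathbb{Z}_2^{R,M}\}$ is the rank of $X$ viewed as a matrix over the two-element field $\mathbb{Z}_2$, where $\otimes$ is matrix multiplication over $\mathbb{Z}_2$. *)

theory Defs
  imports "Jordan_Normal_Form.Matrix" "HOL-Library.Z2" Complex_Main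
begin

definition factor_rank :: "'a::semiring_1 mat \<Rightarrow> nat" where
  "factor_rank X =
    (LEAST R. \<exists>W \<in> carrier_mat (dim_row X) R. \<exists>H \<in> carrier_mat R (dim_col X). X = W * H)"

text \<open>The trivial factorization \<open>X = X * 1\<close> shows that the minimum is always attained.\<close>

lemma factor_rank_attained:
  fixes X :: "'a::semiring_1 mat"
  shows "\<exists>W \<in> carrier_mat (dim_row X) (factor_rank X).
           \<exists>H \<in> carrier_mat (factor_rank X) (dim_col X). X = W * H"
  unfolding factor_rank_def
proof (rule LeastI[where k = "dim_col X"])
  have X: "X \<in> carrier_mat (dim_row X) (dim_col X)" by simp
  show "\<exists>W \<in> carrier_mat (dim_row X) (dim_col X).
          \<exists>H \<in> carrier_mat (dim_col X) (dim_col X). X = W * H"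
    by (rule bexI[OF _ X], rule bexI[OF _ one_carrier_mat]) (simp add: right_mult_one_mat[OF X])
qed

text \<open>
  A matrix with entries in \<open>{0,1}\<close> is given as a matrix of natural numbers, which is then
  interpreted over the reals or over the two-element field \<open>bit\<close>.
\<close>

definition rk_real :: "nat mat \<Rightarrow> nat" where
  "rk_real X = factor_rank (map_mat (of_nat :: nat \<Rightarrow> real) X)"

definition rk_Z2 :: "nat mat \<Rightarrow> nat" where
  "rk_Z2 X = factor_rank (map_mat (of_nat :: nat \<Rightarrow> bit) X)"

end

(* An integer matrix A = W H of inner dimension R in characteristic 0 is factored over an arbitrary
   field k by Wedderburn elimination.  If A vanishes in k there is nothing to do.  Otherwise choose an
   entry A p q that is nonzero in k, hence nonzero.  The integer matrix
   B i j = A p q * A i j - A i q * A p j has a factorization of inner dimension R - 1 in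
   characteristic 0, hence by induction also over k, and A differs from B / A p q by a matrix of
   rank one over k. *)
theory Submission
  imports Defs
begin

text \<open>The inner index set \<open>S\<close> is an arbitrary finite set, so any index can be
  removed in the induction without renumbering.\<close>

lemma factorization_of_int_reduce:
  fixes A :: "'i \<Rightarrow> 'j \<Rightarrow> int" and W :: "'i \<Rightarrow> 'l \<Rightarrow> 'a::field_char_0" and H :: "'l \<Rightarrow> 'j \<Rightarrow> 'a"
  assumes "finite S"
    and "\<And>i j. i \<in> I \<Longrightarrow> j \<in> J \<Longrightarrow> of_int (A i j) = (\<Sum>l\<in>S. W i l * H l j)"
  shows "\<exists>(W' :: 'i \<Rightarrow> 'l \<Rightarrow> 'k::field) H'.
    \<forall>i\<in>I. \<forall>j\<in>J. of_int (A i j) = (\<Sum>l\<in>S. W' i l * H' l j)"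
  using assms
proof (induction S arbitrary: A W H rule: finite_psubset_induct)
  case (psubset S)
  note A = psubset.prems
  show ?case
  \<comment> \<open>The base case is contained in the first branch: for empty \<open>S\<close>,
    \<open>A\<close> is zero on \<open>I\<close> and \<open>J\<close> by characteristic 0.\<close>
  proof (cases "\<forall>i\<in>I. \<forall>j\<in>J. (of_int (A i j) :: 'k) = 0")
    case True
    then show ?thesis
      by (intro exI[of _ "\<lambda>_ _. 0"]) simp
  next
    case False
    then obtain p q where p: "p \<in> I" and q: "q \<in> J" and a_k: "(of_int (A p q) :: 'k) \<noteq> 0"
      by auto
    have "A p q \<noteq> 0"
      using a_k by auto
    then have "(\<Sum>l\<in>S. W p l * H l q) \<noteq> 0"
      using A[OF p q] by (metis of_int_eq_0_iff)
    then obtain k where k: "k \<in> S" and Hk: "H k q \<noteq> 0"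
      by (metis (no_types, lifting) mult_zero_right sum.neutral)
    \<comment> \<open>Without division by the pivot, \<open>B\<close> stays integral and has an
      image in both fields. \<open>V\<close> is \<open>W\<close> under the same row
      operation.\<close>
    define B where "B i j = A p q * A i j - A i q * A p j" for i j
    define V where "V i l = of_int (A p q) * W i l - of_int (A i q) * W p l" for i l
    \<comment> \<open>Subtracting a multiple of column \<open>q\<close> makes row \<open>k\<close>
      of \<open>G\<close> zero, so the index \<open>k\<close> drops out.\<close>
    define G where "G l j = H l j - H k j * H l q / H k q" for l j
    have V: "of_int (B i j) = (\<Sum>l\<in>S. V i l * H l j)" if "i \<in> I" "j \<in> J" for i j
      by (simp add: B_def V_def A that p left_diff_distrib sum_subtractf sum_distrib_left mult.assoc)
    have "of_int (B i j) = (\<Sum>l\<in>S - {k}. V i l * G l j)" if i: "i \<in> I" and j: "j \<in> J" for i j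
    proof -
      \<comment> \<open>\<open>B\<close> vanishes in column \<open>q\<close>, which is a linear relation between the columns of \<open>V\<close>.\<close>
      have "(\<Sum>l\<in>S. V i l * H l q) = 0"
        using V[OF i q] by (simp add: B_def mult.commute)
      then have "(\<Sum>l\<in>S. V i l * G l j) = of_int (B i j)"
        by (simp add: V[OF i j] G_def right_diff_distrib sum_subtractf mult.left_commute[of _ "H k j"]
            flip: sum_divide_distrib sum_distrib_left)
      then show ?thesis
        using k Hk psubset.hyps by (simp add: sum.remove[of S k] G_def)
    qed
    then obtain W' H' where IH:
      "\<forall>i\<in>I. \<forall>j\<in>J. (of_int (B i j) :: 'k) = (\<Sum>l\<in>S - {k}. W' i l * H' l j)"
      using psubset.IH[of "S - {k}" B V G] k by blast
    define a where "a = (of_int (A p q) :: 'k)"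
    \<comment> \<open>The freed index \<open>k\<close> carries the rank-one term: column
      \<open>q\<close> times row \<open>p\<close> of \<open>A\<close>, divided by the pivot.\<close>
    define U where "U i l = (if l = k then of_int (A i q) else W' i l) / a" for i l
    define F where "F l j = (if l = k then of_int (A p j) else H' l j)" for l j
    have "of_int (A i j) = (\<Sum>l\<in>S. U i l * F l j)" if "i \<in> I" "j \<in> J" for i j
    proof -
      have "(\<Sum>l\<in>S. U i l * F l j) = of_int (A i q) * of_int (A p j) / a + of_int (B i j) / a"
        using k that IH psubset.hyps
        by (simp add: sum.remove[of S k] U_def F_def sum_divide_distrib)
      also have "\<dots> = of_int (A i j)"
        using a_k by (simp add: B_def a_def field_simps)
      finally show ?thesis by simp
    qed
    then show ?thesis by blast
  qed
qed

lemma factor_rank_le: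
  assumes "W \<in> carrier_mat (dim_row X) R" "H \<in> carrier_mat R (dim_col X)" "X = W * H"
  shows "factor_rank X \<le> R"
  unfolding factor_rank_def using assms by (intro Least_le) blast

text \<open>A minimal factorization over \<open>'a\<close> yields one over \<open>'k\<close> with
  the same inner dimension.\<close>

lemma factor_rank_of_int_le:
  fixes X :: "int mat"
  shows "factor_rank (map_mat of_int X :: 'k::field mat)
    \<le> factor_rank (map_mat of_int X :: 'a::field_char_0 mat)"
proof -
  let ?N = "dim_row X" and ?M = "dim_col X"
  define R where "R = factor_rank (map_mat of_int X :: 'a mat)"
  obtain W H where W: "W \<in> carrier_mat ?N R" and H: "H \<in> carrier_mat R ?M"
    and X: "(map_mat of_int X :: 'a mat) = W * H"
    using factor_rank_attained[of "map_mat of_int X :: 'a mat"] by (auto simp: R_def)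
  have "of_int (X $$ (i, j)) = (\<Sum>l\<in>{0..<R}. W $$ (i, l) * H $$ (l, j))"
    if "i \<in> {0..<?N}" "j \<in> {0..<?M}" for i j
    using arg_cong[OF X, of "\<lambda>Y. Y $$ (i, j)"] W H that by (simp add: scalar_prod_def)
  then have "\<exists>W' H'. \<forall>i\<in>{0..<?N}. \<forall>j\<in>{0..<?M}.
      (of_int (X $$ (i, j)) :: 'k) = (\<Sum>l\<in>{0..<R}. W' i l * H' l j)"
    by (rule factorization_of_int_reduce[OF finite_atLeastLessThan])
  then obtain W' H' where eq: "\<forall>i\<in>{0..<?N}. \<forall>j\<in>{0..<?M}.
      (of_int (X $$ (i, j)) :: 'k) = (\<Sum>l\<in>{0..<R}. W' i l * H' l j)"
    by (elim exE)
  have "map_mat of_int X = mat ?N R (\<lambda>(i, l). W' i l) * mat R ?M (\<lambda>(l, j). H' l j)"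
    using eq by (intro eq_matI) (simp_all add: scalar_prod_def)
  then show ?thesis
    unfolding R_def[symmetric] by (intro factor_rank_le) simp_all
qed

theorem theorem2:
  fixes X :: "nat mat" and N M :: nat
  assumes "X \<in> carrier_mat N M"
    and "elements_mat X \<subseteq> {0, 1}"
  shows "rk_Z2 X \<le> rk_real X"
proof -
  \<comment> \<open>Both readings of \<open>X\<close> come from one integer matrix, with
    \<open>bit\<close> as \<open>'k\<close> and \<open>real\<close> as \<open>'a\<close>.\<close>
  have "map_mat of_nat X = (map_mat of_int (map_mat int X) :: bit mat)"
    and "map_mat of_nat X = (map_mat of_int (map_mat int X) :: real mat)"
    by (auto intro!: eq_matI)
  then show ?thesis
    unfolding rk_Z2_def rk_real_def by (simp only: factor_rank_of_int_le)
qed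

end
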